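(* For every $n,r$ with $r\le n$, there exists an $n$-vertex directed graph $G$ and a set $S$ of $r$ vertices such that any 2-fault-tolerant reachability subgraph of $G$ for the pair set $S\times S$ has $\Omega(rn)$ edges.
   Context: A subgraph $H$ of $G=(V,E)$ is a $k$-fault-tolerant reachability subgraph of $G$ for $\mathcal{P}\subseteq V\times V$ if for every $(s,t)\in\mathcal{P}$ and every $F\subseteq E$ with $|F|\le k$, $t$ is reachable from $s$ in $G\setminus F$ iff $t$ is reachable from $s$ in $H\setminus F$.
   Formalization: The case r = 1 is excluded: there S×S contains only (s,s), s always reaches itself, so the edgeless subgraph is 2-fault-tolerant for every G and no bound Ω(n) can hold. *)

theory Defs
  imports Complex_Main "Graph_Theory.Digraph_Component"
begin

definition delete_arcs :: "('a, 'b) pre_digraph \<Rightarrow> 'b set \<Rightarrow> ('a, 'b) pre_digraph" where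
  "delete_arcs G F = G\<lparr>arcs := arcs G - F\<rparr>"

(* subgraph does not force verts H = verts G.  Since reachable requires both endpoints to be
   vertices, a vertex missing from H is unreachable in H, even from itself. *)
definition ft_reachability_subgraph ::
  "nat \<Rightarrow> ('a, 'b) pre_digraph \<Rightarrow> ('a \<times> 'a) set \<Rightarrow> ('a, 'b) pre_digraph \<Rightarrow> bool" where
  "ft_reachability_subgraph k G P H \<longleftrightarrow>
     subgraph H G \<and>
     (\<forall>(s, t) \<in> P. \<forall>F \<subseteq> arcs G. card F \<le> k \<longrightarrow>
        (s \<rightarrow>\<^sup>*\<^bsub>delete_arcs G F\<^esub> t \<longleftrightarrow> s \<rightarrow>\<^sup>*\<^bsub>delete_arcs H F\<^esub> t))"

end

theory Submission
  imports Defs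
begin

text \<open>
  Let \<open>k = r div 2\<close>. Take \<open>k\<close> disjoint directed paths \<open>x\<^sup>a\<close> starting at sources, \<open>k\<close> disjoint
  directed paths \<open>y\<^sup>b\<close> ending at sinks, each with \<open>m = n div (2 * k)\<close> vertices, and all rungs
  from the \<open>i\<close>-th vertex of \<open>x\<^sup>a\<close> to the \<open>i\<close>-th vertex of \<open>y\<^sup>b\<close>. Cutting \<open>x\<^sup>a\<close> just after
  position \<open>i\<close> and \<open>y\<^sup>b\<close> just before position \<open>i\<close> leaves the \<open>i\<close>-th rung as the only connection
  from the source of \<open>x\<^sup>a\<close> to the sink of \<open>y\<^sup>b\<close>, so all \<open>k * k * m\<close> rungs are needed.
\<close>

text \<open>Layer \<open>i\<close> consists of the numbers \<open>v\<close> with \<open>v div (2 * k) = i\<close>; the residue \<open>v mod (2 * k)\<close>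
  selects the path, residues below \<open>k\<close> being those of the source paths.\<close>

definition ladder_arcs :: "nat \<Rightarrow> nat \<Rightarrow> (nat \<times> nat) set" where
  "ladder_arcs k m = {(u, v). u < 2 * k * m \<and> v < 2 * k * m \<and>
     (v = u + 2 * k \<or> u div (2 * k) = v div (2 * k) \<and> u mod (2 * k) < k \<and> k \<le> v mod (2 * k))}"

text \<open>The numbers from \<open>2 * k * m\<close> up to \<open>n - 1\<close> are isolated
  vertices; they pad the graph to exactly \<open>n\<close> vertices when \<open>2 * k\<close> does
  not divide \<open>n\<close>.\<close>

definition ladder :: "nat \<Rightarrow> nat \<Rightarrow> nat \<Rightarrow> (nat, nat \<times> nat) pre_digraph" where
  "ladder n k m = \<lparr>verts = {..<n}, arcs = ladder_arcs k m, tail = fst, head = snd\<rparr>"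

definition rung :: "nat \<Rightarrow> nat \<times> nat \<times> nat \<Rightarrow> nat \<times> nat" where
  "rung k = (\<lambda>(i, a, b). (2 * k * i + a, 2 * k * i + k + b))"

lemma ladder_simps [simp]:
  "verts (ladder n k m) = {..<n}" "arcs (ladder n k m) = ladder_arcs k m"
  "tail (ladder n k m) = fst" "head (ladder n k m) = snd"
  by (simp_all add: ladder_def)

lemma delete_arcs_simps [simp]:
  "verts (delete_arcs G F) = verts G" "arcs (delete_arcs G F) = arcs G - F"
  "tail (delete_arcs G F) = tail G" "head (delete_arcs G F) = head G"
  by (simp_all add: delete_arcs_def)

lemma finite_ladder_arcs: "finite (ladder_arcs k m)"
  by (rule finite_subset[of _ "{..<2 * k * m} \<times> {..<2 * k * m}"]) (auto simp: ladder_arcs_def)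

lemma digraph_ladder:
  assumes "2 * k * m \<le> n"
  shows "digraph (ladder n k m)"
proof (unfold_locales)
  show "e \<in> arcs (ladder n k m) \<Longrightarrow> tail (ladder n k m) e \<noteq> head (ladder n k m) e" for e
    by (auto simp: ladder_arcs_def)
qed (use assms finite_ladder_arcs in \<open>auto simp: ladder_arcs_def arc_to_ends_def prod_eq_iff\<close>)

lemma layer_less:
  fixes i m c x :: nat
  assumes "i < m" "x < c"
  shows "c * i + x < c * m"
proof -
  have "c * i + x < c * Suc i" using assms by simp
  also have "\<dots> \<le> c * m" using assms by (intro mult_left_mono) auto
  finally show ?thesis .
qed

lemma inj_on_rung: "inj_on (rung k) ({..<m} \<times> {..<k} \<times> {..<k})"
proof (rule inj_onI, clarsimp simp: rung_def)
  fix i a b i' a' b'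
  assume a: "a < k" "a' < k" and eq: "2 * k * i + a = 2 * k * i' + a'"
    and eq': "2 * k * i + b = 2 * k * i' + b'"
  have "(2 * k * i + a) div (2 * k) = i" "(2 * k * i' + a') div (2 * k) = i'"
    using a by simp_all
  then have "i = i'" using eq by simp
  then show "i = i' \<and> a = a' \<and> b = b'" using eq eq' by simp
qed

lemma reachable_path:
  assumes wf: "wf_digraph D" and "x \<in> verts D"
    and "\<And>l. l < j \<Longrightarrow> (x + c * l) \<rightarrow>\<^bsub>D\<^esub> (x + c * Suc l)"
  shows "x \<rightarrow>\<^sup>*\<^bsub>D\<^esub> (x + c * j)"
  using assms(3)
proof (induction j)
  case 0
  then show ?case using assms(2) wf by (simp add: wf_digraph.reachable_refl)
next
  case (Suc j)
  then have "x \<rightarrow>\<^sup>*\<^bsub>D\<^esub> (x + c * j)" by simp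
  then show ?case using Suc.prems[of j] wf by (meson lessI wf_digraph.reachable_adj_trans)
qed

text \<open>Serves to refute reachability: a set closed under the surviving arcs that contains the
  source and misses the sink separates them.\<close>

lemma reachable_closed:
  assumes "u \<rightarrow>\<^sup>*\<^bsub>D\<^esub> v" "u \<in> R"
    and "\<And>e. e \<in> arcs D \<Longrightarrow> tail D e \<in> R \<Longrightarrow> head D e \<in> R"
  shows "v \<in> R"
  using assms(1) unfolding reachable_def
proof (induction rule: rtrancl_on_induct)
  case base
  then show ?case using assms(2) by simp
next
  case (step v w)
  then show ?case using assms(3) by (auto simp: arcs_ends_def arc_to_ends_def)
qed

lemma rung_needed:
  assumes n: "2 * k * m \<le> n"
    and H: "ft_reachability_subgraph 2 (ladder n k m) P H"
    and ab: "i < m" "a < k" "b < k"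
    and P: "(a, k + b + 2 * k * (m - 1)) \<in> P"
  shows "rung k (i, a, b) \<in> arcs H"
proof (rule ccontr)
  define c where "c = 2 * k"
  define s where "s = a + c * i"
  define t where "t = k + b + c * i"
  define z where "z = k + b + c * (m - 1)"
  assume "rung k (i, a, b) \<notin> arcs H"
  then have st: "(s, t) \<notin> arcs H" by (simp add: rung_def s_def t_def c_def add_ac)
  interpret G: digraph "ladder n k m" by (rule digraph_ladder[OF n])
  have sub: "arcs H \<subseteq> ladder_arcs k m" and hd: "tail H = fst" "head H = snd"
    using H by (auto simp: ft_reachability_subgraph_def subgraph_def compatible_def)
  have c0: "0 < c" "a < c" "k + b < c" using ab by (auto simp: c_def)
  have cm: "c * m \<le> n" using n by (simp add: c_def)
  have arcs: "(u, v) \<in> ladder_arcs k m \<longleftrightarrow> u < c * m \<and> v < c * m \<and>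
     (v = u + c \<or> u div c = v div c \<and> u mod c < k \<and> k \<le> v mod c)" for u v
    by (simp add: ladder_arcs_def c_def)
  have lay: "x + c * j < c * m" if "j < m" "x < c" for x j
    using layer_less[OF that] by (simp add: add.commute)
  \<comment> \<open>\<open>F\<close> holds the path arc leaving \<open>s\<close> and the path arc
    entering \<open>t\<close>. In the last layer the former does not exist, in layer 0 the latter;
    selecting from \<open>ladder_arcs\<close> covers these cases, so \<open>F\<close> always
    consists of arcs of the ladder.\<close>
  define F where "F = {(u, v) \<in> ladder_arcs k m. v = u + c \<and> (u = s \<or> v = t)}"
  have "F \<subseteq> {(s, s + c), (t - c, t)}" by (auto simp: F_def)
  then have "card F \<le> card {(s, s + c), (t - c, t)}" by (intro card_mono) auto
  also have "\<dots> \<le> 2" by (simp add: card_insert_if)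
  finally have cardF: "card F \<le> 2" .
  let ?G = "delete_arcs (ladder n k m) F"
  have wf: "wf_digraph ?G"
    using G.wf_digraph by (auto simp: wf_digraph_def)
  have dom: "u \<rightarrow>\<^bsub>?G\<^esub> v" if "(u, v) \<in> ladder_arcs k m" "(u, v) \<notin> F" for u v
    using that by (force simp: arcs_ends_def arc_to_ends_def)
  have st_res: "s mod c = a" "s div c = i" "t mod c = k + b" "t div c = i"
    using c0 by (simp_all add: s_def t_def)
  \<comment> \<open>The surviving route in the ladder follows the source path to \<open>s\<close>,
    crosses the rung to \<open>t\<close> and follows the sink path to \<open>z\<close>. The two path
    segments avoid \<open>F\<close> because residues modulo \<open>c\<close> tell source paths from
    sink paths and because the first stops at \<open>s\<close> and the second starts at
    \<open>t\<close>.\<close>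
  have "a \<rightarrow>\<^sup>*\<^bsub>?G\<^esub> s" unfolding s_def
  proof (rule reachable_path[OF wf])
    show "a \<in> verts ?G" using lay[of 0 a] cm c0 ab by simp
    fix l assume l: "l < i"
    have "a + c * l \<noteq> s" using l c0 by (simp add: s_def)
    moreover have "a + c * Suc l \<noteq> t"
    proof
      assume "a + c * Suc l = t"
      then have "(a + c * Suc l) mod c = t mod c" by simp
      then show False using c0 st_res ab by (simp del: mult_Suc_right)
    qed
    moreover have "a + c * l < c * m" "a + c * Suc l < c * m"
      using lay[of l a] lay[of "Suc l" a] l ab c0 by simp_all
    ultimately show "(a + c * l) \<rightarrow>\<^bsub>?G\<^esub> (a + c * Suc l)"
      by (intro dom) (auto simp: arcs F_def)
  qed
  moreover have "s \<rightarrow>\<^bsub>?G\<^esub> t"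
  proof (rule dom)
    show "(s, t) \<in> ladder_arcs k m"
      using lay[of i a] lay[of i "k + b"] ab c0 st_res by (simp add: arcs s_def t_def)
    show "(s, t) \<notin> F" using st_res c0 by (auto simp: F_def)
  qed
  moreover have "t \<rightarrow>\<^sup>*\<^bsub>?G\<^esub> (t + c * (m - 1 - i))"
  proof (rule reachable_path[OF wf])
    show "t \<in> verts ?G" using lay[of i "k + b"] cm c0 ab by (simp add: t_def)
    fix l assume l: "l < m - 1 - i"
    have eq: "t + c * l = k + b + c * (i + l)" "t + c * Suc l = k + b + c * (i + Suc l)"
      by (simp_all add: t_def algebra_simps)
    have "t + c * l \<noteq> s"
    proof
      assume "t + c * l = s"
      then have "(t + c * l) mod c = s mod c" by simp
      then show False using st_res ab by simp
    qed
    moreover have "t + c * Suc l \<noteq> t" using c0 by simp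
    moreover have "t + c * l < c * m" "t + c * Suc l < c * m"
      unfolding eq using lay[of "i + l" "k + b"] lay[of "i + Suc l" "k + b"] l ab c0 by simp_all
    ultimately show "(t + c * l) \<rightarrow>\<^bsub>?G\<^esub> (t + c * Suc l)"
      by (intro dom) (auto simp: arcs F_def)
  qed
  moreover have "t + c * (m - 1 - i) = z"
  proof -
    have "m - 1 = i + (m - 1 - i)" using ab by simp
    then have "c * (m - 1) = c * i + c * (m - 1 - i)" by (metis distrib_left)
    then show ?thesis by (simp add: t_def z_def)
  qed
  ultimately have "a \<rightarrow>\<^sup>*\<^bsub>?G\<^esub> z"
    by (metis wf wf_digraph.reachable_adj_trans wf_digraph.reachable_trans)
  moreover have "F \<subseteq> arcs (ladder n k m)" by (auto simp: F_def)
  moreover have "(a, z) \<in> P" using P by (simp add: z_def c_def)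
  ultimately have reach: "a \<rightarrow>\<^sup>*\<^bsub>delete_arcs H F\<^esub> z"
    using H cardF unfolding ft_reachability_subgraph_def by blast

  \<comment> \<open>\<open>R\<close> consists of the source path of \<open>a\<close> up to
    \<open>s\<close>, all of the other sink paths, and the sink path of \<open>b\<close> strictly
    before \<open>t\<close>. The only ladder arcs leaving \<open>R\<close> are those in
    \<open>F\<close> and the rung \<open>(s, t)\<close>, all absent from \<open>H\<close> without
    \<open>F\<close>.\<close>
  define R where "R = {v. v mod c = a \<and> v \<le> s \<or> k \<le> v mod c \<and> (v mod c = k + b \<longrightarrow> v < t)}"
  have "z \<in> R" using reach
  proof (rule reachable_closed)
    show "a \<in> R" using c0 by (simp add: R_def s_def)
  next
    fix e assume e: "e \<in> arcs (delete_arcs H F)" and "tail (delete_arcs H F) e \<in> R"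
    obtain u v where uv: "e = (u, v)" by force
    have u: "u \<in> R" and l: "(u, v) \<in> ladder_arcs k m" "(u, v) \<notin> F" "(u, v) \<in> arcs H"
      using e uv hd sub \<open>tail (delete_arcs H F) e \<in> R\<close> by auto
    \<comment> \<open>Consecutive vertices of a path differ by \<open>c\<close>, so a path arc
      cannot jump over \<open>s\<close> or \<open>t\<close>.\<close>
    have upto: "x + c \<le> y" if "x < y" "x mod c = y mod c" for x y
    proof -
      have "c dvd y - x" using that mod_eq_dvd_iff_nat[of x y c] by simp
      then have "c \<le> y - x" using that by (intro dvd_imp_le) auto
      then show ?thesis using that by simp
    qed
    consider "v = u + c" | "u div c = v div c" "u mod c < k" "k \<le> v mod c"
      using l(1) by (auto simp: arcs)
    then have "v \<in> R"
    proof cases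
      case 1
      then have ne: "u \<noteq> s" "v \<noteq> t" using l by (auto simp: F_def)
      then show ?thesis using u upto[of u s] upto[of u t] st_res 1 by (auto simp: R_def)
    next
      case 2
      then have us: "u mod c = a" "u \<le> s" using u by (auto simp: R_def)
      \<comment> \<open>A rung stays in its layer. Starting at or before \<open>s\<close>, it can
        hit the sink path of \<open>b\<close> at \<open>t\<close> or later only as
        \<open>(s, t)\<close> itself, which \<open>H\<close> lacks.\<close>
      have "v < t" if vb: "v mod c = k + b"
      proof -
        have "v div c \<le> i" using us(2) st_res 2(1) by (metis div_le_mono)
        moreover have "v div c \<noteq> i"
        proof
          assume "v div c = i"
          then have "v = t" "u = s"
            using vb us st_res 2(1) by (metis div_mult_mod_eq)+
          then show False using st l by simp
        qed
        ultimately have "v div c < t div c" using st_res by simp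
        then show ?thesis by (meson div_le_mono leD leI)
      qed
      then show ?thesis using 2 by (simp add: R_def)
    qed
    then show "head (delete_arcs H F) e \<in> R" using uv hd by simp
  qed
  \<comment> \<open>The sink \<open>z\<close> lies on the sink path of \<open>b\<close> at or after
    \<open>t\<close>, hence outside \<open>R\<close>.\<close>
  moreover have "t \<le> z" unfolding t_def z_def using ab by (intro add_left_mono mult_left_mono) auto
  moreover have "z mod c = k + b" using c0 by (simp add: z_def)
  ultimately show False using ab by (auto simp: R_def)
qed

text \<open>The factor 12 is 3 times 4. For positive \<open>k\<close>, rounding \<open>r\<close>
  gives r \<le> 2k + 1 \<le> 3k, and the remainder of \<open>n\<close> is below 2k \<le> 2km, so n
  \<le> 4km. If \<open>k = 0\<close>, then \<open>r = 0\<close> because \<open>r\<close> is not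
  1.\<close>

lemma rung_count_bound:
  fixes n r :: nat
  assumes "r \<le> n" "r \<noteq> 1"
  defines "k \<equiv> r div 2"
  shows "r * n \<le> 12 * (k * k * (n div (2 * k)))"
proof (cases "k = 0")
  case True
  then have "r = 0" using assms by auto
  then show ?thesis by simp
next
  case False
  define m where "m = n div (2 * k)"
  have "2 * k \<le> n" using assms by simp
  then have "1 \<le> m" using False by (simp add: m_def less_eq_div_iff_mult_less_eq)
  have "n = 2 * k * m + n mod (2 * k)" by (simp add: m_def)
  also have "\<dots> \<le> 2 * k * m + 2 * k * 1" using False by simp
  also have "\<dots> \<le> 2 * k * m + 2 * k * m" using \<open>1 \<le> m\<close> by (intro add_left_mono mult_left_mono) auto
  finally have "n \<le> 4 * (k * m)" by simp
  moreover have "r \<le> 3 * k" using False by (auto simp: k_def)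
  ultimately have "r * n \<le> (3 * k) * (4 * (k * m))" by (intro mult_mono) auto
  then show ?thesis by (simp add: m_def mult_ac)
qed

text \<open>The case \<open>r = 1\<close> has to be excluded: the only pair is then
  \<open>(s, s)\<close>, and the subgraph with all vertices and no arcs preserves it.\<close>

theorem theorem8p1:
  shows "\<exists>c::real. c > 0 \<and>
    (\<forall>n r::nat. r \<le> n \<and> r \<noteq> 1 \<longrightarrow>
      (\<exists>(G :: (nat, nat \<times> nat) pre_digraph) S.
         digraph G \<and> card (verts G) = n \<and> S \<subseteq> verts G \<and> card S = r \<and>
         (\<forall>H. ft_reachability_subgraph 2 G (S \<times> S) H \<longrightarrow>
            real (card (arcs H)) \<ge> c * real r * real n)))"
proof (intro exI[of _ "1 / 12"] conjI allI impI)
  fix n r :: nat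
  assume "r \<le> n \<and> r \<noteq> 1"
  then have r: "r \<le> n" "r \<noteq> 1" by auto
  define k where "k = r div 2"
  \<comment> \<open>For \<open>r = 0\<close> division by zero makes \<open>m = 0\<close>, and the
    ladder has no arcs.\<close>
  define m where "m = n div (2 * k)"
  have n: "2 * k * m \<le> n" by (simp add: m_def)
  \<comment> \<open>\<open>T\<close> collects the sources, in layer 0, and the sinks, in layer
    \<open>m - 1\<close>.\<close>
  define T where "T = {..<k} \<union> (\<lambda>b. k + b + 2 * k * (m - 1)) ` {..<k}"
  have "T \<subseteq> {..<n}"
  proof (cases "k = 0")
    case False
    have "2 * k \<le> n" using r by (simp add: k_def)
    then have "0 < m" using False by (simp add: m_def div_greater_zero_iff)
    then have "k + b + 2 * k * (m - 1) < 2 * k * m" if "b < k" for b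
      using layer_less[of "m - 1" m "k + b" "2 * k"] that by (simp add: add.commute)
    then show ?thesis using n \<open>2 * k \<le> n\<close> by (fastforce simp: T_def)
  qed (simp add: T_def)
  moreover have "card T \<le> r"
  proof -
    have "card T \<le> k + k"
      unfolding T_def using card_image_le[of "{..<k}" "\<lambda>b. k + b + 2 * k * (m - 1)"]
      by (intro order_trans[OF card_Un_le]) auto
    then show ?thesis by (simp add: k_def)
  qed
  \<comment> \<open>Extra terminals bring the size to exactly \<open>r\<close>, for instance when
    \<open>r\<close> is odd; the source-sink pairs that force the rungs remain in
    \<open>S \<times> S\<close>.\<close>
  ultimately obtain S where S: "T \<subseteq> S" "S \<subseteq> {..<n}" "card S = r"
    using exists_subset_between[of T r "{..<n}"] r by auto
  have "1 / 12 * real r * real n \<le> real (card (arcs H))"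
    if H: "ft_reachability_subgraph 2 (ladder n k m) (S \<times> S) H" for H
  proof -
    have "arcs H \<subseteq> ladder_arcs k m"
      using H by (auto simp: ft_reachability_subgraph_def subgraph_def)
    then have fin: "finite (arcs H)" using finite_ladder_arcs finite_subset by blast
    have "rung k (i, a, b) \<in> arcs H" if "i < m" "a < k" "b < k" for i a b
      using that S by (intro rung_needed[OF n H]) (auto simp: T_def)
    then have "rung k ` ({..<m} \<times> {..<k} \<times> {..<k}) \<subseteq> arcs H" by auto
    then have "card (rung k ` ({..<m} \<times> {..<k} \<times> {..<k})) \<le> card (arcs H)"
      by (rule card_mono[OF fin])
    then have "k * k * m \<le> card (arcs H)"
      by (simp add: card_image[OF inj_on_rung] card_cartesian_product mult_ac)
    then have "r * n \<le> 12 * card (arcs H)"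
      using rung_count_bound[OF r] unfolding k_def m_def by linarith
    then have "real (r * n) \<le> real (12 * card (arcs H))" by (rule of_nat_mono)
    then show ?thesis by simp
  qed
  then show "\<exists>(G :: (nat, nat \<times> nat) pre_digraph) S.
         digraph G \<and> card (verts G) = n \<and> S \<subseteq> verts G \<and> card S = r \<and>
         (\<forall>H. ft_reachability_subgraph 2 G (S \<times> S) H \<longrightarrow>
            real (card (arcs H)) \<ge> 1 / 12 * real r * real n)"
    using digraph_ladder[OF n] S by (intro exI[of _ "ladder n k m"] exI[of _ S]) simp
qed simp

end
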